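(* For every real number $k \geq 3$, $I_{K_{2,2,1}}\!\left(\frac{k-1}{k}\right) \le \frac{15(k-1)(k-2)}{k^4}$. Moreover, equality holds when $k \geq 3$ is an integer.
   Context: For graphs $H$ and $G$, let $I(H,G)$ denote the number of induced subgraphs of $G$ isomorphic to $H$, and define the (induced) density $p(H,G) = I(H,G)/\binom{|V(G)|}{|V(H)|}$. For $e\in[0,1]$, define $I_H(e) = \limsup_{n\to\infty} \max\{p(H,G) : G \text{ an } n\text{-vertex graph with } p(K_2,G) = e + o(1)\}$, i.e. the supremum, over all sequences of graphs $(G_n)$ with $|V(G_n)|\to\infty$ and edge density $p(K_2,G_n)\to e$, of $\limsup_n p(H,G_n)$. Here $K_{2,2,1}$ is the complete $3$-partite graph on $5$ vertices with parts of sizes $2,2,1$. *)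

theory Defs
  imports Complex_Main "HOL-Library.Extended_Real"
begin

text \<open>A graph is a pair (vertex set, edge set), edges being two-element sets of vertices.\<close>

type_synonym 'a sgraph = "'a set \<times> 'a set set"

abbreviation vset :: "'a sgraph \<Rightarrow> 'a set" where
  "vset G \<equiv> fst G"

abbreviation eset :: "'a sgraph \<Rightarrow> 'a set set" where
  "eset G \<equiv> snd G"

definition fin_simple_graph :: "'a sgraph \<Rightarrow> bool" where
  "fin_simple_graph G \<longleftrightarrow> finite (vset G) \<and> (\<forall>e \<in> eset G. e \<subseteq> vset G \<and> card e = 2)"

definition graph_iso :: "'a sgraph \<Rightarrow> 'b sgraph \<Rightarrow> bool" where
  "graph_iso G H \<longleftrightarrow> (\<exists>f. bij_betw f (vset G) (vset H) \<and>
     (\<forall>u \<in> vset G. \<forall>v \<in> vset G. {u, v} \<in> eset G \<longleftrightarrow> {f u, f v} \<in> eset H))"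

definition induced_sub :: "'a sgraph \<Rightarrow> 'a set \<Rightarrow> 'a sgraph" where
  "induced_sub G W = (W, {e \<in> eset G. e \<subseteq> W})"

text \<open>Induced subgraphs are counted through their vertex sets, which determine them.\<close>

definition ind_count :: "'b sgraph \<Rightarrow> 'a sgraph \<Rightarrow> nat" where
  "ind_count H G = card {W. W \<subseteq> vset G \<and> graph_iso (induced_sub G W) H}"

definition ind_density :: "'b sgraph \<Rightarrow> 'a sgraph \<Rightarrow> real" where
  "ind_density H G = real (ind_count H G) / real (card (vset G) choose card (vset H))"

text \<open>The vertex \<open>(i, j)\<close> is the \<open>j\<close>-th vertex of the \<open>i\<close>-th part; \<open>ps\<close> lists the part sizes.\<close>

definition complete_multipartite :: "nat list \<Rightarrow> (nat \<times> nat) sgraph" where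
  "complete_multipartite ps =
     (let V = {(i, j). i < length ps \<and> j < ps ! i}
      in (V, {{u, v} | u v. u \<in> V \<and> v \<in> V \<and> fst u \<noteq> fst v}))"

definition K221 :: "(nat \<times> nat) sgraph" where
  "K221 = complete_multipartite [2, 2, 1]"

definition complete_graph :: "nat \<Rightarrow> nat sgraph" where
  "complete_graph n = ({..<n}, {e. e \<subseteq> {..<n} \<and> card e = 2})"

text \<open>Every finite graph is isomorphic to one with vertices in \<^typ>\<open>nat\<close>, so the supremum over
  sequences of graphs may be taken over graphs of that kind.  Extended reals make \<open>limsup\<close> and
  the supremum total.\<close>

definition graph_seqs :: "real \<Rightarrow> (nat \<Rightarrow> nat sgraph) set" where
  "graph_seqs e = {G. (\<forall>n. fin_simple_graph (G n)) \<and>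
     filterlim (\<lambda>n. card (vset (G n))) at_top sequentially \<and>
     (\<lambda>n. ind_density (complete_graph 2) (G n)) \<longlonglongrightarrow> e}"

definition max_ind_density :: "'b sgraph \<Rightarrow> real \<Rightarrow> ereal" where
  "max_ind_density H e = (SUP G \<in> graph_seqs e. limsup (\<lambda>n. ereal (ind_density H (G n))))"

end

theory Submission
  imports Defs "HOL-Real_Asymp.Real_Asymp"
begin

text \<open>Let \<open>d x\<close> be the fraction of vertices not adjacent to \<open>x\<close>, and \<open>s = 1/k\<close> its average.  Count the
  copies of \<open>K221\<close> through a vertex \<open>x\<close> of a part of size two: its partner is one of the non-neighbours
  of \<open>x\<close>, and the rest of the copy is an induced path \<open>y, w, y'\<close> in the neighbourhood of \<open>x\<close>.
  In a vertex set of measure \<open>\<beta>\<close> there are at most \<open>D * (\<beta> - D)\<close> choices for \<open>(y', w)\<close> if \<open>y\<close> has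
  non-degree \<open>D\<close>; linearising this in \<open>D\<close> bounds the number of copies by an average
  of a function \<open>theta s (d x) (d y)\<close> over non-adjacent pairs \<open>(x, y)\<close>.
  After symmetrisation in \<open>x\<close> and \<open>y\<close> this function lies below its tangent in the variables
  \<open>1 / d x\<close> and \<open>1 / d y\<close> at \<open>d x = d y = s\<close>, whose average depends on the edge density only.
  All steps are equalities for balanced complete \<open>k\<close>-partite graphs, which also give the lower bound
  for integral \<open>k\<close>.\<close>

section \<open>A pointwise inequality\<close>

text \<open>\<open>tangent s\<close> is, as a function of \<open>1 / a\<close>, the tangent line at \<open>a = s\<close> to
  \<open>\<lambda>a. theta s a a\<close>.  The averages of \<open>1\<close> and of \<open>1 / d x\<close> over non-adjacent pairs are fixed by
  the edge density, which is why \<open>1 / a\<close> is the right variable.\<close>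

definition tangent :: "real \<Rightarrow> real \<Rightarrow> real" where
  "tangent s a = s * (1 - s) * (1 - 2 * s) - 3 * s\<^sup>2 * (1 - 2 * s) * (1 - s / a)"

text \<open>Here \<open>a\<close> stands for \<open>d x\<close> and \<open>b\<close> for
  \<open>d y\<close>. The first branch comes from the bound linearised at \<open>s\<close>; the
  second is the maximum of \<open>D * (\<beta> - D)\<close> times the measure
  \<open>\<beta> = 1 - a\<close> of the neighbourhood. Both equal \<open>2 * s ^ 3\<close> at
  \<open>a = 1 - 2 * s\<close>.\<close>

definition theta :: "real \<Rightarrow> real \<Rightarrow> real \<Rightarrow> real" where
  "theta s a b = (if a \<le> 1 - 2 * s then (s - a * b) * (1 - 2 * s - a) + s\<^sup>2 * (1 - a)
                  else (1 - a) ^ 3 / 4)"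

text \<open>Multiplying by \<open>a\<close> makes the tangent affine in \<open>a\<close>, so
  comparisons with it become polynomial inequalities.\<close>

lemma mult_tangent:
  assumes "a > 0"
  shows "a * tangent s a = s * (1 - 2 * s) * (a * (1 - 4 * s) + 3 * s\<^sup>2)"
  using assms by (simp add: tangent_def field_simps power2_eq_square)

text \<open>With \<open>c = 1 - a\<close> in \<open>[0, 2 * s]\<close>, the product
  \<open>(1 - c) * c\<^sup>2\<close> is at most its value at \<open>c = 2 * s\<close>. What remains
  is affine in \<open>c\<close> and is settled at the two endpoints.\<close>

lemma cubic_le_tangent:
  assumes s: "0 < s" "s \<le> 1/3" and a: "1 - 2 * s \<le> a" "a \<le> 1"
  shows "(1 - a) ^ 3 / 4 \<le> tangent s a"
proof -
  define c where "c = 1 - a"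
  have c: "0 \<le> c" "c \<le> 2 * s" and a_eq: "a = 1 - c" and a0: "a > 0"
    using s a by (auto simp: c_def)
  \<comment> \<open>This is the cofactor of \<open>2 * s - c\<close> in
    \<open>4 * (1 - 2 * s) * s\<^sup>2 - (1 - c) * c\<^sup>2\<close>.\<close>
  have "0 \<le> c * (1 - 2 * s - c) + 2 * s * (1 - 2 * s)"
  proof (cases "1 - 2 * s - c \<ge> 0")
    case True
    then show ?thesis using s c by (intro add_nonneg_nonneg mult_nonneg_nonneg) auto
  next
    case False
    then have "2 * s * (1 - 2 * s - c) \<le> c * (1 - 2 * s - c)"
      using c by (intro mult_right_mono_neg) auto
    moreover have "0 \<le> 2 * s * (2 - 4 * s - c)"
      using s c by (intro mult_nonneg_nonneg) auto
    ultimately show ?thesis by (simp add: algebra_simps)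
  qed
  then have "0 \<le> (2 * s - c) * (c * (1 - 2 * s - c) + 2 * s * (1 - 2 * s))"
    using c by simp
  then have "(1 - c) * c\<^sup>2 \<le> 4 * (1 - 2 * s) * s\<^sup>2"
    by (simp add: algebra_simps power2_eq_square)
  then have "(1 - c) * c\<^sup>2 * c \<le> 4 * (1 - 2 * s) * s\<^sup>2 * c"
    using c by (intro mult_right_mono)
  then have 1: "a * ((1 - a) ^ 3 / 4) \<le> s * (1 - 2 * s) * (s * c)"
    by (simp add: a_eq field_simps power2_eq_square power3_eq_cube)
  \<comment> \<open>Interpolation, scaled by \<open>2 * s\<close>, of an affine function between its
    values at \<open>c = 0\<close> and \<open>c = 2 * s\<close>.\<close>
  have "0 \<le> (2 * s - c) * ((1 - s) * (1 - 3 * s)) + c * (1 - 3 * s)\<^sup>2"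
    using s c by (intro add_nonneg_nonneg mult_nonneg_nonneg) auto
  also have "\<dots> = 2 * s * (a * (1 - 4 * s) + 3 * s\<^sup>2 - s * c)"
    by (simp add: a_eq algebra_simps power2_eq_square)
  finally have "s * c \<le> a * (1 - 4 * s) + 3 * s\<^sup>2"
    using s by (simp add: zero_le_mult_iff)
  then have "s * (1 - 2 * s) * (s * c) \<le> s * (1 - 2 * s) * (a * (1 - 4 * s) + 3 * s\<^sup>2)"
    using s by (intro mult_left_mono) auto
  with 1 have "a * ((1 - a) ^ 3 / 4) \<le> a * tangent s a"
    using a0 by (simp add: mult_tangent)
  then show ?thesis using a0 mult_le_cancel_left_pos by blast
qed

text \<open>Boundary case \<open>b = 1 - 2 * s\<close>, used both for one end of the affine argument
  in the pair inequality and when only one variable exceeds the threshold. Multiplying by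
  \<open>a\<close> reduces it to \<open>p \<ge> 0\<close>, treated separately on the two sides of
  \<open>a = s\<close>.\<close>

lemma theta_edge_le_tangent:
  assumes s: "0 < s" "s \<le> 1/3" and a: "0 < a" "a \<le> 1 - 2 * s"
  shows "(s - a * (1 - 2 * s)) * (1 - 2 * s - a) + s\<^sup>2 * (1 - a) \<le> tangent s a"
proof -
  define u v where "u = 1 - 2 * s" and "v = 1 - 3 * s"
  define p where "p = a\<^sup>2 * u * (u - a) + s * (1 + s) * a\<^sup>2 - s\<^sup>2 * (5 - 8 * s) * a + 3 * s ^ 3 * u"
  have uv: "u > 0" "v \<ge> 0" "u = s + v" "v = 1 - 3 * s" using s by (auto simp: u_def v_def)
  have "p \<ge> 0"
  proof (cases "a \<ge> s")
    case True
    show ?thesis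
    proof (cases "v = 0")
      case True
      with s have "s = 1/3" by (simp add: v_def)
      with a \<open>a \<ge> s\<close> have "a = 1/3" by simp
      show ?thesis unfolding p_def u_def \<open>a = 1/3\<close> \<open>s = 1/3\<close>
        by (simp add: power2_eq_square power3_eq_cube)
    next
      case False
      \<comment> \<open>On \<open>[s, u] = [s, s + v]\<close> the cubic \<open>p\<close> vanishes to order \<open>v\<^sup>2\<close> under this scaling.\<close>
      define t where "t = (a - s) / v"
      have a_eq: "a = s + t * v" using False by (simp add: t_def)
      have "(a - s) \<le> 1 * v" using a uv u_def by linarith
      then have t: "0 \<le> t" "t \<le> 1" using True uv False by (auto simp: t_def divide_le_eq)
      have "p = v\<^sup>2 * (s\<^sup>2 * (1 - 2 * t)\<^sup>2 + s * v * t\<^sup>2 + (s + v) * (1 - t) * t * (2 * s + t * v))"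
        unfolding p_def a_eq u_def v_def by algebra
      also have "\<dots> \<ge> 0"
        using s uv t by (intro mult_nonneg_nonneg add_nonneg_nonneg) auto
      finally show ?thesis .
    qed
  next
    case False
    \<comment> \<open>Below \<open>s\<close> the scale is \<open>s\<close> itself: rescaling
      \<open>a\<close> and homogenising with \<open>1 = 3 * s + v\<close> leaves only products of
      non-negative factors.\<close>
    define t where "t = a / s"
    have a_eq: "a = s * t" and t: "0 \<le> t" "t \<le> 1" using s a False by (auto simp: t_def)
    have "p = s\<^sup>2 * (v\<^sup>2 * t\<^sup>2 + s * v * (1 - t) * ((t - 1)\<^sup>2 + 2) + s\<^sup>2 * (1 - t)\<^sup>2 * (3 - t))"
      unfolding p_def a_eq u_def v_def by algebra
    also have "\<dots> \<ge> 0"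
      using s uv t by (intro mult_nonneg_nonneg add_nonneg_nonneg) auto
    finally show ?thesis .
  qed
  also have "p = a * tangent s a - a * ((s - a * u) * (u - a) + s\<^sup>2 * (1 - a))"
    using a by (simp add: mult_tangent p_def u_def algebra_simps power2_eq_square power3_eq_cube)
  finally have "a * ((s - a * u) * (u - a) + s\<^sup>2 * (1 - a)) \<le> a * tangent s a" by simp
  then show ?thesis using a mult_le_cancel_left_pos unfolding u_def by blast
qed

lemma theta_pair_le_tangent:
  assumes s: "0 < s" "s \<le> 1/3" and a: "0 < a" "a \<le> 1 - 2 * s" and b: "0 < b" "b \<le> 1 - 2 * s"
  shows "(s - a * b) * (1 - 2 * s - a) + s\<^sup>2 * (1 - a) + ((s - b * a) * (1 - 2 * s - b) + s\<^sup>2 * (1 - b))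
         \<le> tangent s a + tangent s b"
proof -
  define u where "u = 1 - 2 * s"
  \<comment> \<open>For a fixed product \<open>P = a * b\<close> the inequality is affine in the sum \<open>S = a + b\<close>, so it suffices
    to check \<open>a = b\<close> and \<open>b = u\<close>.\<close>
  define F where "F = (\<lambda>P S. (2 * u - S) * P + s * (1 + s) * S + 3 * s ^ 3 * u * (S / P)
    - (10 * s\<^sup>2 - 16 * s ^ 3))"
  have F: "F (x * y) (x + y) = tangent s x + tangent s y
      - ((s - x * y) * (u - x) + s\<^sup>2 * (1 - x) + ((s - y * x) * (u - y) + s\<^sup>2 * (1 - y)))"
    if "x > 0" "y > 0" for x y
    using that by (simp add: F_def tangent_def u_def field_simps power2_eq_square power3_eq_cube)
  define P t where "P = a * b" and "t = sqrt (a * b)"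
  have P: "P > 0" and u: "u > 0" and t: "t > 0" "t * t = P"
    using a b s by (auto simp: P_def t_def u_def)
  have "a * b \<le> u * u" using a b by (intro mult_mono) (auto simp: u_def)
  then have tu: "t \<le> u" using u t power2_le_imp_le[of t u] by (simp add: P_def power2_eq_square)
  \<comment> \<open>The double root at \<open>t = s\<close> reflects the tangency at
    \<open>a = b = s\<close>.\<close>
  have "0 \<le> (t - s)\<^sup>2 * (2 * t * (u - t) + (2 * s * (u - t)) + 4 * s * (u - t) + 2 * s * t)"
    using t tu s by (intro mult_nonneg_nonneg add_nonneg_nonneg) auto
  also have "\<dots> = t * F P (2 * t)"
    using t unfolding F_def u_def t(2)[symmetric]
    by (simp add: field_simps power2_eq_square power3_eq_cube)
  finally have low: "0 \<le> F P (2 * t)" using t by (simp add: zero_le_mult_iff)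
  \<comment> \<open>This end of the range is the pair \<open>P / u\<close>, \<open>u\<close>, where
    the sum splits into the boundary inequality at \<open>P / u\<close> and a bound at
    \<open>u\<close>.\<close>
  have high: "0 \<le> F P (u + P / u)"
  proof -
    have Pu: "0 < P / u" "P / u \<le> u" using P u \<open>a * b \<le> u * u\<close> by (auto simp: P_def divide_le_eq)
    have "0 \<le> F (P / u * u) (P / u + u)"
      using theta_edge_le_tangent[OF s, of "P / u"] theta_edge_le_tangent[OF s, of u] Pu u
        cubic_le_tangent[OF s, of u] s
      by (subst F) (auto simp: u_def power2_eq_square power3_eq_cube algebra_simps)
    then show ?thesis using u by (simp add: add.commute)
  qed
  have S: "2 * t \<le> a + b" "a + b \<le> u + P / u"
  proof -
    show "2 * t \<le> a + b" using arith_geo_mean_sqrt[of a b] a b by (simp add: t_def)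
    have "0 \<le> (u - a) * (u - b)" using a b by (simp add: u_def)
    then show "a + b \<le> u + P / u" using u by (simp add: P_def field_simps)
  qed
  \<comment> \<open>Slope of \<open>F P\<close> in the sum; its sign decides which end of the range
    is the smaller one.\<close>
  define k where "k = s * (1 + s) - P + 3 * s ^ 3 * u / P"
  have F_affine: "F P S = 2 * u * P - (10 * s\<^sup>2 - 16 * s ^ 3) + k * S" for S
    by (simp add: F_def k_def algebra_simps)
  have "0 \<le> F P (a + b)"
  proof (cases "k \<ge> 0")
    case True
    then have "k * (2 * t) \<le> k * (a + b)" using S by (intro mult_left_mono)
    then show ?thesis using low by (simp add: F_affine)
  next
    case False
    then have "k * (u + P / u) \<le> k * (a + b)" using S by (intro mult_left_mono_neg) auto
    then show ?thesis using high by (simp add: F_affine)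
  qed
  then show ?thesis using F[of a b] a b by (simp add: P_def u_def)
qed

text \<open>As soon as one variable exceeds the threshold \<open>1 - 2 * s\<close>, each half is
  bounded by its own tangent value; below it on both sides only the symmetrised sum is
  compared.\<close>

lemma theta_sym_le_tangent:
  assumes s: "0 < s" "s \<le> 1/3" and ab: "0 < a" "a \<le> 1" "0 < b" "b \<le> 1"
  shows "theta s a b + theta s b a \<le> tangent s a + tangent s b"
proof -
  have mixed: "theta s x y + theta s y x \<le> tangent s x + tangent s y"
    if x: "0 < x" "x \<le> 1 - 2 * s" and y: "1 - 2 * s < y" "y \<le> 1" for x y
  proof -
    \<comment> \<open>For \<open>x\<close> below the threshold, \<open>theta s x y\<close> decreases
      in \<open>y\<close>, so \<open>y\<close> may be lowered to \<open>1 - 2 * s\<close>.\<close>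
    have "x * (1 - 2 * s) * (1 - 2 * s - x) \<le> x * y * (1 - 2 * s - x)"
      using x y by (intro mult_right_mono mult_left_mono) auto
    then have "theta s x y \<le> tangent s x"
      using theta_edge_le_tangent[OF s x] x by (simp add: theta_def algebra_simps)
    then show ?thesis using cubic_le_tangent[OF s, of y] y by (simp add: theta_def)
  qed
  consider "a \<le> 1 - 2 * s" "b \<le> 1 - 2 * s" | "a \<le> 1 - 2 * s" "1 - 2 * s < b"
    | "1 - 2 * s < a" "b \<le> 1 - 2 * s" | "1 - 2 * s < a" "1 - 2 * s < b" by linarith
  then show ?thesis
  proof cases
    case 1
    then show ?thesis using theta_pair_le_tangent[OF s] ab by (simp add: theta_def)
  next
    case 2
    then show ?thesis using mixed ab by simp
  next
    case 3
    then show ?thesis using mixed[of b a] ab by simp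
  next
    case 4
    then show ?thesis using cubic_le_tangent[OF s, of a] cubic_le_tangent[OF s, of b] ab
      by (simp add: theta_def)
  qed
qed

section \<open>Averages over a symmetric reflexive relation\<close>

definition avg :: "'a set \<Rightarrow> ('a \<Rightarrow> real) \<Rightarrow> real" where
  "avg V f = (\<Sum>x\<in>V. f x) / real (card V)"

lemma avg_mono: "(\<And>x. x \<in> V \<Longrightarrow> f x \<le> g x) \<Longrightarrow> avg V f \<le> avg V g"
  unfolding avg_def by (intro divide_right_mono sum_mono) auto

lemma avg_nonneg: "(\<And>x. x \<in> V \<Longrightarrow> 0 \<le> f x) \<Longrightarrow> 0 \<le> avg V f"
  unfolding avg_def by (intro divide_nonneg_nonneg sum_nonneg) auto

lemma avg_cong: "(\<And>x. x \<in> V \<Longrightarrow> f x = g x) \<Longrightarrow> avg V f = avg V g"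
  unfolding avg_def by simp

lemma avg_add: "avg V (\<lambda>x. f x + g x) = avg V f + avg V g"
  by (simp add: avg_def sum.distrib add_divide_distrib)

lemma avg_diff: "avg V (\<lambda>x. f x - g x) = avg V f - avg V g"
  by (simp add: avg_def sum_subtractf diff_divide_distrib)

lemma avg_cmult: "avg V (\<lambda>x. c * f x) = c * avg V f"
  by (simp add: avg_def sum_distrib_left)

lemma avg_cmult_right: "avg V (\<lambda>x. f x * c) = avg V f * c"
  by (simp add: avg_def sum_distrib_right)

lemma avg_const: "finite V \<Longrightarrow> V \<noteq> {} \<Longrightarrow> avg V (\<lambda>x. c) = c"
  by (simp add: avg_def)

lemma avg_swap: "avg V (\<lambda>x. avg V (f x)) = avg V (\<lambda>y. avg V (\<lambda>x. f x y))"
  using sum.swap[of f V V] by (simp add: avg_def flip: sum_divide_distrib)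

text \<open>\<open>r\<close> is the indicator of non-adjacency. Reflexivity makes \<open>d\<close>
  positive on \<open>V\<close>, so that \<open>1 / d x\<close> makes sense there.\<close>

locale nonadjacency =
  fixes V :: "'a set" and r :: "'a \<Rightarrow> 'a \<Rightarrow> real"
  assumes V: "finite V" "V \<noteq> {}"
    and r01: "r x y = 0 \<or> r x y = 1"
    and r_sym: "r x y = r y x"
    and r_refl: "r x x = 1"
begin

definition e :: "'a \<Rightarrow> 'a \<Rightarrow> real" where "e x y = 1 - r x y"

definition d :: "'a \<Rightarrow> real" where "d x = avg V (r x)"

definition s :: real where "s = avg V d"

definition m :: "'a \<Rightarrow> real" where "m x = avg V (\<lambda>y. r x y * d y)"

text \<open>Non-degree of \<open>y\<close> measured inside the neighbourhood of \<open>x\<close>;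
  thus \<open>1 - d x - D x y\<close> measures the common neighbourhood of \<open>x\<close> and
  \<open>y\<close>.\<close>

definition D :: "'a \<Rightarrow> 'a \<Rightarrow> real" where "D x y = avg V (\<lambda>y'. r y y' * e x y')"

definition C :: "'a \<Rightarrow> real" where "C x = avg V (\<lambda>y. e x y * (D x y * (1 - d x - D x y)))"

lemma r_range: "0 \<le> r x y" "r x y \<le> 1" "0 \<le> e x y" "e x y \<le> 1"
  using r01[of x y] by (auto simp: e_def)

lemma d_range: "0 \<le> d x" "d x \<le> 1"
  using avg_mono[of V "r x" "\<lambda>_. 1"] V by (auto simp: d_def r_range avg_const intro: avg_nonneg)

lemma d_pos:
  assumes "x \<in> V"
  shows "0 < d x"
proof -
  have "r x x \<le> (\<Sum>y\<in>V. r x y)" using V assms by (intro member_le_sum) (auto simp: r_range)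
  then show ?thesis using V by (simp add: d_def avg_def r_refl card_gt_0_iff)
qed

lemma s_range: "0 \<le> s" "s \<le> 1"
  using avg_mono[of V d "\<lambda>_. 1"] V by (auto simp: s_def d_range avg_const intro: avg_nonneg)

lemma D_nonneg: "0 \<le> D x y"
  unfolding D_def by (intro avg_nonneg) (simp add: r_range)

text \<open>Since the adjacency of \<open>y'\<close> and \<open>w\<close> is dropped, the averages
  over \<open>y'\<close> and \<open>w\<close> separate once \<open>x\<close> and \<open>y\<close>
  are fixed.\<close>

lemma C_eq: "avg V (\<lambda>y. avg V (\<lambda>y'. avg V (\<lambda>w. r y y' * e x y * e x y' * e x w * e y w))) = C x"
proof -
  have common: "avg V (\<lambda>w. e x w * e y w) = 1 - d x - D x y" for y
  proof -
    have "avg V (\<lambda>w. e x w * e y w) = avg V (\<lambda>w. 1 - r x w - r y w * e x w)"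
      by (intro avg_cong) (simp add: e_def algebra_simps)
    then show ?thesis using V by (simp add: avg_diff avg_const D_def d_def)
  qed
  have "avg V (\<lambda>w. r y y' * e x y * e x y' * e x w * e y w)
      = e x y * (1 - d x - D x y) * (r y y' * e x y')" for y y'
    using avg_cmult[of V "r y y' * e x y * e x y'" "\<lambda>w. e x w * e y w", unfolded common]
    by (simp add: mult_ac)
  then have "avg V (\<lambda>y'. avg V (\<lambda>w. r y y' * e x y * e x y' * e x w * e y w))
        = e x y * (D x y * (1 - d x - D x y))" for y
    by (simp only: avg_cmult) (simp add: D_def)
  then show ?thesis by (simp add: C_def)
qed

lemma avg_e: "avg V (e x) = 1 - d x"
  using V by (simp add: e_def[abs_def] avg_diff avg_const d_def)

text \<open>Double counting of non-adjacent pairs \<open>y\<close>, \<open>y'\<close> with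
  \<open>y'\<close> adjacent to \<open>x\<close>: each such \<open>y'\<close> contributes
  \<open>d y'\<close>.\<close>

lemma avg_D: "avg V (D x) = s - m x"
proof -
  have "avg V (D x) = avg V (\<lambda>y'. avg V (\<lambda>y. r y y' * e x y'))"
    unfolding D_def[abs_def] by (rule avg_swap)
  also have "\<dots> = avg V (\<lambda>y'. d y' * e x y')"
    using r_sym by (simp add: avg_cmult_right d_def)
  also have "\<dots> = avg V (\<lambda>y'. d y' - r x y' * d y')"
    by (intro avg_cong) (simp add: e_def algebra_simps)
  finally show ?thesis by (simp add: avg_diff s_def m_def)
qed

text \<open>Linearisation \<open>t * (\<beta> - t) \<le> t * (\<beta> - 2 * l) + l\<^sup>2\<close>, used below with \<open>l = \<sigma>\<close> where \<open>d x\<close> allows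
  it and with the largest admissible \<open>l\<close> otherwise; this is the case distinction in \<open>theta\<close>.\<close>

lemma C_le:
  assumes "2 * l \<le> 1 - d x"
  shows "C x \<le> (1 - d x - 2 * l) * (s - m x) + l\<^sup>2 * (1 - d x)"
proof -
  have "C x \<le> avg V (\<lambda>y. (1 - d x - 2 * l) * D x y + l\<^sup>2 * e x y)"
    unfolding C_def
  proof (intro avg_mono)
    fix y
    have "D x y * (1 - d x - D x y) \<le> (1 - d x - 2 * l) * D x y + l\<^sup>2"
      using zero_le_power2[of "D x y - l"] by (simp add: algebra_simps power2_eq_square)
    then have "e x y * (D x y * (1 - d x - D x y)) \<le> e x y * ((1 - d x - 2 * l) * D x y + l\<^sup>2)"
      using r_range by (intro mult_left_mono)
    \<comment> \<open>Dropping \<open>e x y\<close> from the linear term makes \<open>avg_D\<close>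
      applicable; this is where \<open>2 * l \<le> 1 - d x\<close> enters. In a complete
      multipartite graph nothing is lost, because \<open>D x y = 0\<close> for non-adjacent
      \<open>x\<close> and \<open>y\<close>.\<close>
    also have "\<dots> \<le> (1 - d x - 2 * l) * D x y + l\<^sup>2 * e x y"
    proof -
      have "e x y * ((1 - d x - 2 * l) * D x y) \<le> (1 - d x - 2 * l) * D x y"
        using r_range D_nonneg assms by (intro mult_left_le_one_le mult_nonneg_nonneg) auto
      then show ?thesis by (simp add: distrib_left mult.commute[of "e x y" "l\<^sup>2"])
    qed
    finally show "e x y * (D x y * (1 - d x - D x y)) \<le> (1 - d x - 2 * l) * D x y + l\<^sup>2 * e x y" .
  qed
  also have "\<dots> = (1 - d x - 2 * l) * (s - m x) + l\<^sup>2 * (1 - d x)"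
    by (simp add: avg_add avg_cmult avg_e avg_D)
  finally show ?thesis .
qed

section \<open>Comparison of the count with the tangent\<close>

context
  fixes \<sigma> :: real
  assumes sigma: "0 < \<sigma>" "\<sigma> \<le> 1/3"
begin

text \<open>The factor \<open>d x\<close> is the average of \<open>r x y\<close> over
  \<open>y\<close>, and \<open>m x\<close> that of \<open>r x y * d y\<close>; hence
  \<open>d x\<close> times the bound on \<open>C x\<close> is an average over the non-neighbours
  \<open>y\<close> of \<open>x\<close>.\<close>

lemma d_C_le: "d x * C x \<le> avg V (\<lambda>y. r x y * (theta \<sigma> (d x) (d y) + \<bar>s - \<sigma>\<bar>))"
proof (cases "d x \<le> 1 - 2 * \<sigma>")
  case True
  have "d x * C x \<le> d x * ((1 - d x - 2 * \<sigma>) * (s - m x) + \<sigma>\<^sup>2 * (1 - d x))"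
    using C_le[of \<sigma> x] True d_range by (intro mult_left_mono) auto
  also have "\<dots> = avg V (\<lambda>y. r x y * ((s - d x * d y) * (1 - 2 * \<sigma> - d x) + \<sigma>\<^sup>2 * (1 - d x)))"
  proof -
    have "avg V (\<lambda>y. r x y * ((s - d x * d y) * (1 - 2 * \<sigma> - d x) + \<sigma>\<^sup>2 * (1 - d x)))
      = avg V (\<lambda>y. r x y * (s * (1 - 2 * \<sigma> - d x) + \<sigma>\<^sup>2 * (1 - d x))
          - (r x y * d y) * (d x * (1 - 2 * \<sigma> - d x)))"
      by (intro avg_cong) (simp add: algebra_simps)
    also have "\<dots> = d x * (s * (1 - 2 * \<sigma> - d x) + \<sigma>\<^sup>2 * (1 - d x)) - m x * (d x * (1 - 2 * \<sigma> - d x))"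
      by (simp only: avg_diff avg_cmult_right d_def m_def)
    finally show ?thesis by (simp add: algebra_simps)
  qed
  also have "\<dots> \<le> avg V (\<lambda>y. r x y * (theta \<sigma> (d x) (d y) + \<bar>s - \<sigma>\<bar>))"
  proof (intro avg_mono mult_left_mono r_range)
    fix y
    \<comment> \<open>The summand \<open>\<bar>s - \<sigma>\<bar>\<close> pays for replacing
      \<open>s\<close> by \<open>\<sigma>\<close>, as the other factor lies in
      \<open>[0, 1]\<close>.\<close>
    have "(s - \<sigma>) * (1 - 2 * \<sigma> - d x) \<le> \<bar>s - \<sigma>\<bar> * 1"
      using True sigma d_range[of x] by (intro mult_mono) auto
    then show "(s - d x * d y) * (1 - 2 * \<sigma> - d x) + \<sigma>\<^sup>2 * (1 - d x) \<le> theta \<sigma> (d x) (d y) + \<bar>s - \<sigma>\<bar>"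
      using True by (simp add: theta_def algebra_simps)
  qed
  finally show ?thesis .
next
  case False
  \<comment> \<open>With \<open>l = (1 - d x) / 2\<close> the term containing \<open>m x\<close>
    disappears.\<close>
  have eq: "1 - d x - 2 * ((1 - d x) / 2) = 0" by simp
  have "C x \<le> 0 * (s - m x) + ((1 - d x) / 2)\<^sup>2 * (1 - d x)"
    using C_le[of "(1 - d x) / 2" x, unfolded eq] by simp
  then have "C x \<le> (1 - d x) ^ 3 / 4" by (simp add: power2_eq_square power3_eq_cube)
  then have "d x * C x \<le> d x * ((1 - d x) ^ 3 / 4)"
    using d_range by (intro mult_left_mono)
  also have "\<dots> \<le> d x * ((1 - d x) ^ 3 / 4 + \<bar>s - \<sigma>\<bar>)"
    using d_range by (intro mult_left_mono) auto
  also have "\<dots> = avg V (\<lambda>y. r x y * (theta \<sigma> (d x) (d y) + \<bar>s - \<sigma>\<bar>))"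
    using False by (simp add: theta_def avg_cmult_right) (simp add: d_def)
  finally show ?thesis .
qed

text \<open>A double average equals that of its transpose, so the symmetrised pointwise inequality
  suffices. Averaging \<open>r x y\<close> over \<open>y\<close> then produces the weight
  \<open>d x\<close>.\<close>

lemma avg_theta_le: "avg V (\<lambda>x. avg V (\<lambda>y. r x y * (theta \<sigma> (d x) (d y) + \<bar>s - \<sigma>\<bar>)))
    \<le> avg V (\<lambda>x. d x * (tangent \<sigma> (d x) + \<bar>s - \<sigma>\<bar>))"
proof -
  define W where "W = (\<lambda>x y. r x y * (theta \<sigma> (d x) (d y) + \<bar>s - \<sigma>\<bar>))"
  define L where "L = (\<lambda>x. tangent \<sigma> (d x) + \<bar>s - \<sigma>\<bar>)"
  have W_sym: "W x y + W y x \<le> r x y * L x + r y x * L y" if "x \<in> V" "y \<in> V" for x y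
  proof -
    have "theta \<sigma> (d x) (d y) + theta \<sigma> (d y) (d x) \<le> tangent \<sigma> (d x) + tangent \<sigma> (d y)"
      by (intro theta_sym_le_tangent sigma d_pos d_range that)
    then have "r x y * (theta \<sigma> (d x) (d y) + theta \<sigma> (d y) (d x)) \<le> r x y * (tangent \<sigma> (d x) + tangent \<sigma> (d y))"
      by (intro mult_left_mono r_range)
    then show ?thesis by (simp add: W_def L_def r_sym[of y x] algebra_simps)
  qed
  have avg_L: "avg V (\<lambda>x. avg V (\<lambda>y. r x y * L x)) = avg V (\<lambda>x. d x * L x)"
    by (simp add: avg_cmult_right d_def)
  have "2 * avg V (\<lambda>x. avg V (W x)) = avg V (\<lambda>x. avg V (\<lambda>y. W x y + W y x))"
    using avg_swap[of V W] by (simp add: avg_add)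
  also have "\<dots> \<le> avg V (\<lambda>x. avg V (\<lambda>y. r x y * L x + r y x * L y))"
    by (intro avg_mono W_sym)
  also have "\<dots> = 2 * avg V (\<lambda>x. d x * L x)"
    using avg_swap[of V "\<lambda>x y. r x y * L x"] by (simp add: avg_add avg_L)
  finally show ?thesis by (simp add: W_def L_def)
qed

text \<open>For \<open>x\<close> in \<open>V\<close> the summand is affine in \<open>d x\<close>, so
  its average is determined by \<open>s\<close>.\<close>

lemma avg_tangent: "avg V (\<lambda>x. d x * (tangent \<sigma> (d x) + \<bar>s - \<sigma>\<bar>))
    = s * (\<sigma> * (1 - \<sigma>) * (1 - 2 * \<sigma>)) - 3 * \<sigma>\<^sup>2 * (1 - 2 * \<sigma>) * (s - \<sigma>) + s * \<bar>s - \<sigma>\<bar>"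
proof -
  define c where "c = \<sigma> * (1 - \<sigma>) * (1 - 2 * \<sigma>) - 3 * \<sigma>\<^sup>2 * (1 - 2 * \<sigma>) + \<bar>s - \<sigma>\<bar>"
  have "d x * (tangent \<sigma> (d x) + \<bar>s - \<sigma>\<bar>) = d x * c + 3 * \<sigma>\<^sup>2 * (1 - 2 * \<sigma>) * \<sigma>" if "x \<in> V" for x
    using d_pos[OF that] by (simp add: c_def tangent_def field_simps)
  then have "avg V (\<lambda>x. d x * (tangent \<sigma> (d x) + \<bar>s - \<sigma>\<bar>))
      = avg V (\<lambda>x. d x * c + 3 * \<sigma>\<^sup>2 * (1 - 2 * \<sigma>) * \<sigma>)"
    by (rule avg_cong)
  also have "\<dots> = s * c + 3 * \<sigma>\<^sup>2 * (1 - 2 * \<sigma>) * \<sigma>"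
    using V by (simp add: avg_add avg_cmult_right avg_const s_def)
  finally show ?thesis by (simp add: c_def algebra_simps)
qed

text \<open>A tuple \<open>(x, x', y, y', w)\<close> stands for an induced \<open>K221\<close> with parts \<open>{x, x'}\<close>, \<open>{y, y'}\<close>,
  \<open>{w}\<close>; the adjacencies of \<open>x'\<close> and the adjacency of \<open>y'\<close> and \<open>w\<close> are dropped.  The parameter \<open>\<sigma>\<close> is kept
  apart from \<open>s\<close> because along a sequence of graphs \<open>s\<close> only tends to \<open>\<sigma>\<close> and may exceed \<open>1/3\<close>.\<close>

lemma avg_K221_le:
  "avg V (\<lambda>x. d x * avg V (\<lambda>y. avg V (\<lambda>y'. avg V (\<lambda>w. r y y' * e x y * e x y' * e x w * e y w))))
    \<le> s * (\<sigma> * (1 - \<sigma>) * (1 - 2 * \<sigma>)) - 3 * \<sigma>\<^sup>2 * (1 - 2 * \<sigma>) * (s - \<sigma>) + \<bar>s - \<sigma>\<bar>"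
proof -
  have "avg V (\<lambda>x. d x * C x) \<le> avg V (\<lambda>x. avg V (\<lambda>y. r x y * (theta \<sigma> (d x) (d y) + \<bar>s - \<sigma>\<bar>)))"
    by (intro avg_mono d_C_le)
  also note avg_theta_le
  also note avg_tangent
  also have "s * \<bar>s - \<sigma>\<bar> \<le> \<bar>s - \<sigma>\<bar>"
    using s_range by (intro mult_left_le_one_le) auto
  finally show ?thesis unfolding C_eq by simp
qed

end

end

section \<open>Copies of K221 and the upper bound\<close>

lemma vset_K221: "vset K221 = {(0, 0), (0, 1), (1, 0), (1, 1), (2, 0)}"
  by (auto simp: K221_def complete_multipartite_def Let_def less_Suc_eq nth_Cons numeral_2_eq_2 numeral_3_eq_3
      split: nat.splits)

lemma eset_K221: "{p, q} \<in> eset K221 \<longleftrightarrow> p \<in> vset K221 \<and> q \<in> vset K221 \<and> fst p \<noteq> fst q"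
proof -
  have "eset K221 = {{u, v} | u v. u \<in> vset K221 \<and> v \<in> vset K221 \<and> fst u \<noteq> fst v}"
    by (simp add: K221_def complete_multipartite_def Let_def)
  then have "{p, q} \<in> eset K221 \<longleftrightarrow>
      (\<exists>u v. {p, q} = {u, v} \<and> u \<in> vset K221 \<and> v \<in> vset K221 \<and> fst u \<noteq> fst v)"
    by (simp only: mem_Collect_eq)
  then show ?thesis unfolding doubleton_eq_iff by metis
qed

text \<open>Labelled copies. In a loopless graph the listed edges force the distinctness of the
  remaining pairs of entries.\<close>

definition K221_tuple :: "'a sgraph \<Rightarrow> 'a \<times> 'a \<times> 'a \<times> 'a \<times> 'a \<Rightarrow> bool" where
  "K221_tuple G = (\<lambda>(x, x', y, y', w). x \<noteq> x' \<and> y \<noteq> y' \<and> {x, x', y, y', w} \<subseteq> vset G \<and>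
     {x, x'} \<notin> eset G \<and> {y, y'} \<notin> eset G \<and>
     {x, y} \<in> eset G \<and> {x, y'} \<in> eset G \<and> {x', y} \<in> eset G \<and> {x', y'} \<in> eset G \<and>
     {x, w} \<in> eset G \<and> {x', w} \<in> eset G \<and> {y, w} \<in> eset G \<and> {y', w} \<in> eset G)"

definition tuple_set :: "'a \<times> 'a \<times> 'a \<times> 'a \<times> 'a \<Rightarrow> 'a set" where
  "tuple_set = (\<lambda>(x, x', y, y', w). {x, x', y, y', w})"

lemma edge_commute: "{a, b} \<in> E \<longleftrightarrow> {b, a} \<in> E"
  by (simp add: insert_commute)

lemma no_loop: "fin_simple_graph G \<Longrightarrow> {x} \<notin> eset G"
  by (force simp: fin_simple_graph_def)

lemma K221_tuple_distinct:
  assumes "fin_simple_graph G" "K221_tuple G (x, x', y, y', w)"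
  shows "distinct [x, x', y, y', w]"
  using assms no_loop[OF assms(1)] by (auto simp: K221_tuple_def)

text \<open>The inverse of an isomorphism sends the five standard vertices to a tuple; conversely, a
  tuple gives an isomorphism by sending its entries to these vertices in order.\<close>

lemma graph_iso_K221_iff:
  fixes G :: "'a sgraph"
  assumes G: "fin_simple_graph G"
  shows "W \<subseteq> vset G \<and> graph_iso (induced_sub G W) K221 \<longleftrightarrow> (\<exists>t. K221_tuple G t \<and> tuple_set t = W)"
proof
  assume L: "W \<subseteq> vset G \<and> graph_iso (induced_sub G W) K221"
  then obtain f where f: "bij_betw f W (vset K221)"
    and f_adj: "\<forall>u\<in>W. \<forall>v\<in>W. {u, v} \<in> {e \<in> eset G. e \<subseteq> W} \<longleftrightarrow> {f u, f v} \<in> eset K221"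
    unfolding graph_iso_def induced_sub_def fst_conv snd_conv by blast
  have adj: "{u, v} \<in> eset G \<longleftrightarrow> {f u, f v} \<in> eset K221" if "u \<in> W" "v \<in> W" for u v
    using f_adj that by simp
  define g where "g = inv_into W f"
  have g: "g p \<in> W" "f (g p) = p" if "p \<in> vset K221" for p
    using f that inv_into_into[of p f W] f_inv_into_f[of p f W] by (auto simp: g_def bij_betw_def)
  have W: "W = g ` vset K221"
    using bij_betw_inv_into[OF f] unfolding g_def by (simp add: bij_betw_def)
  have adj_g: "{g p, g q} \<in> eset G \<longleftrightarrow> fst p \<noteq> fst q" if "p \<in> vset K221" "q \<in> vset K221" for p q
    using adj[of "g p" "g q"] g that by (simp add: eset_K221)
  have inj_g: "g p = g q \<longleftrightarrow> p = q" if "p \<in> vset K221" "q \<in> vset K221" for p q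
    using g(2)[OF that(1)] g(2)[OF that(2)] by metis
  have gV: "g p \<in> vset G" if "p \<in> vset K221" for p
    using g(1)[OF that] L by blast
  let ?t = "(g (0, 0), g (0, 1), g (1, 0), g (1, 1), g (2, 0))"
  have "K221_tuple G ?t"
    by (simp add: K221_tuple_def inj_g adj_g gV vset_K221)
  moreover have "tuple_set ?t = W" unfolding W vset_K221 tuple_set_def by simp
  ultimately show "\<exists>t. K221_tuple G t \<and> tuple_set t = W" by blast
next
  assume "\<exists>t. K221_tuple G t \<and> tuple_set t = W"
  then obtain x x' y y' w where t: "K221_tuple G (x, x', y, y', w)" and W: "W = {x, x', y, y', w}"
    by (auto simp: tuple_set_def)
  have dist: "distinct [x, x', y, y', w]" using K221_tuple_distinct[OF G t] .
  define f where "f = (\<lambda>v. if v = x then (0, 0) else if v = x' then (0, 1) else if v = y then (1, 0)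
      else if v = y' then (1, 1) else (2::nat, 0::nat))"
  have f: "f x = (0, 0)" "f x' = (0, 1)" "f y = (1, 0)" "f y' = (1, 1)" "f w = (2, 0)"
    using dist by (auto simp: f_def)
  have bij: "bij_betw f W (vset K221)"
    unfolding bij_betw_def inj_on_def W vset_K221 using f dist by auto
  have adj: "{x, x'} \<notin> eset G" "{y, y'} \<notin> eset G"
     "{x, y} \<in> eset G" "{x, y'} \<in> eset G" "{x', y} \<in> eset G" "{x', y'} \<in> eset G"
     "{x, w} \<in> eset G" "{x', w} \<in> eset G" "{y, w} \<in> eset G" "{y', w} \<in> eset G"
    using t by (simp_all add: K221_tuple_def)
  have adj': "{x', x} \<notin> eset G" "{y', y} \<notin> eset G"
     "{y, x} \<in> eset G" "{y', x} \<in> eset G" "{y, x'} \<in> eset G" "{y', x'} \<in> eset G"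
     "{w, x} \<in> eset G" "{w, x'} \<in> eset G" "{w, y} \<in> eset G" "{w, y'} \<in> eset G"
    using adj edge_commute[of _ _ "eset G"] by blast+
  \<comment> \<open>All 25 pairs are checked. On the diagonal \<open>{u, u}\<close> collapses to a
    singleton, hence the simplified instance of \<open>eset_K221\<close> and
    \<open>no_loop\<close>.\<close>
  have "{u, v} \<in> eset G \<longleftrightarrow> {f u, f v} \<in> eset K221" if "u \<in> W" "v \<in> W" for u v
    using that unfolding W
    by (elim insertE emptyE)
       (simp_all add: f eset_K221 eset_K221[of p p for p, simplified] vset_K221 adj adj' no_loop[OF G])
  with bij have "graph_iso (induced_sub G W) K221"
    unfolding graph_iso_def induced_sub_def fst_conv snd_conv by (intro exI[of _ f]) simp
  then show "W \<subseteq> vset G \<and> graph_iso (induced_sub G W) K221"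
    using t by (auto simp: W K221_tuple_def)
qed

lemma K221_tuple_swap:
  assumes "K221_tuple G (x, x', y, y', w)"
  shows "K221_tuple G (x', x, y, y', w)" "K221_tuple G (y, y', x, x', w)"
  using assms edge_commute[of _ _ "eset G"] unfolding K221_tuple_def by (simp; blast)+

text \<open>The number 8 is the order of the automorphism group of \<open>K221\<close>, generated by
  swapping the vertices of one pair and by exchanging the two pairs.\<close>

lemma card_tuples_with_set:
  fixes G :: "'a sgraph"
  assumes G: "fin_simple_graph G" and "K221_tuple G t"
  shows "8 \<le> card {t'. K221_tuple G t' \<and> tuple_set t' = tuple_set t}"
proof -
  obtain x x' y y' w where t: "t = (x, x', y, y', w)" by (cases t)
  then have T: "K221_tuple G (x, x', y, y', w)" using assms by simp
  have dist: "distinct [x, x', y, y', w]" using K221_tuple_distinct[OF G T] .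
  let ?S = "{(x, x', y, y', w), (x', x, y, y', w), (x, x', y', y, w), (x', x, y', y, w),
             (y, y', x, x', w), (y', y, x, x', w), (y, y', x', x, w), (y', y, x', x, w)}"
  have card_S: "card ?S = 8" using dist by simp
  have sub: "?S \<subseteq> {t'. K221_tuple G t' \<and> tuple_set t' = tuple_set t}"
  proof -
    note swap1 = K221_tuple_swap(1) and swap2 = K221_tuple_swap(2)
    have "K221_tuple G t'" if "t' \<in> ?S" for t'
      using that T swap1[OF T] swap2[OF T] swap1[OF swap2[OF T]] swap2[OF swap1[OF T]]
        swap1[OF swap2[OF swap1[OF T]]] swap2[OF swap1[OF swap2[OF T]]]
        swap2[OF swap1[OF swap2[OF swap1[OF T]]]]
      by (elim insertE emptyE) simp_all
    moreover have "tuple_set t' = tuple_set t" if "t' \<in> ?S" for t'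
      using that unfolding t tuple_set_def by (elim insertE emptyE) (simp_all only: prod.case, blast+)
    ultimately show ?thesis by (intro subsetI CollectI conjI)
  qed
  have fin: "finite {t'. K221_tuple G t' \<and> tuple_set t' = tuple_set t}"
  proof (rule finite_subset)
    show "{t'. K221_tuple G t' \<and> tuple_set t' = tuple_set t}
      \<subseteq> vset G \<times> vset G \<times> vset G \<times> vset G \<times> vset G"
      by (auto simp: K221_tuple_def)
    show "finite (vset G \<times> vset G \<times> vset G \<times> vset G \<times> vset G)"
      using G by (simp add: fin_simple_graph_def)
  qed
  show ?thesis using card_mono[OF fin sub] unfolding card_S .
qed

text \<open>The fibres of \<open>tuple_set\<close> over the copies are disjoint and have at least 8
  elements each.\<close>

lemma ind_count_K221_le_tuples:
  fixes G :: "'a sgraph"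
  assumes G: "fin_simple_graph G"
  shows "8 * ind_count K221 G \<le> card {t. K221_tuple G t}"
proof -
  define F where "F = {W. W \<subseteq> vset G \<and> graph_iso (induced_sub G W) K221}"
  define B where "B = (\<lambda>W. {t. K221_tuple G t \<and> tuple_set t = W})"
  have finV: "finite (vset G)" using G by (simp add: fin_simple_graph_def)
  have finT: "finite {t. K221_tuple G t}"
  proof (rule finite_subset)
    show "{t. K221_tuple G t} \<subseteq> vset G \<times> vset G \<times> vset G \<times> vset G \<times> vset G"
      by (auto simp: K221_tuple_def)
    show "finite (vset G \<times> vset G \<times> vset G \<times> vset G \<times> vset G)"
      using finV by (intro finite_cartesian_product)
  qed
  have finF: "finite F" by (rule finite_subset[of _ "Pow (vset G)"]) (use finV in \<open>auto simp: F_def\<close>)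
  have finB: "finite (B W)" for W by (rule finite_subset[OF _ finT]) (simp add: B_def Collect_mono)
  have disj: "B W \<inter> B W' = {}" if "W \<noteq> W'" for W W' using that unfolding B_def by blast
  have "8 * card F = (\<Sum>W\<in>F. 8)" by simp
  also have "\<dots> \<le> (\<Sum>W\<in>F. card (B W))"
  proof (rule sum_mono)
    fix W assume "W \<in> F"
    then have "\<exists>t. K221_tuple G t \<and> tuple_set t = W"
      unfolding F_def mem_Collect_eq by (rule graph_iso_K221_iff[OF G, THEN iffD1])
    then obtain t where t: "K221_tuple G t" and W: "tuple_set t = W" by (elim exE conjE)
    show "8 \<le> card (B W)" using card_tuples_with_set[OF G t] unfolding W B_def .
  qed
  also have "\<dots> = card (\<Union>W\<in>F. B W)"
    by (rule card_UN_disjoint[symmetric]) (use finF finB disj in blast)+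
  also have "\<dots> \<le> card {t. K221_tuple G t}"
    unfolding B_def by (rule card_mono[OF finT]) blast
  finally show ?thesis by (simp add: ind_count_def F_def)
qed

text \<open>A vertex counts as non-adjacent to itself, as in a blow-up.\<close>

definition nonadj :: "'a sgraph \<Rightarrow> 'a \<Rightarrow> 'a \<Rightarrow> real" where
  "nonadj G x y = of_bool ({x, y} \<notin> eset G)"

text \<open>The product of indicators is 1 on every labelled copy and non-negative on all other
  5-tuples. The vertex \<open>x'\<close> occurs in a single factor, so its sum splits off as the
  non-degree of \<open>x\<close>.\<close>

lemma card_tuples_le_avg:
  fixes G :: "'a sgraph"
  assumes G: "fin_simple_graph G" and ne: "vset G \<noteq> {}"
  defines "V \<equiv> vset G"
  shows "real (card {t. K221_tuple G t}) \<le> real (card V) ^ 5 *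
    avg V (\<lambda>x. avg V (nonadj G x) * avg V (\<lambda>y. avg V (\<lambda>y'. avg V (\<lambda>w.
      nonadj G y y' * (1 - nonadj G x y) * (1 - nonadj G x y') * (1 - nonadj G x w) * (1 - nonadj G y w)))))"
proof -
  have V: "finite V" "card V > 0" using G ne by (auto simp: V_def fin_simple_graph_def card_gt_0_iff)
  define h where "h = (\<lambda>x y y' w.
      nonadj G y y' * (1 - nonadj G x y) * (1 - nonadj G x y') * (1 - nonadj G x w) * (1 - nonadj G y w))"
  have sub: "{t. K221_tuple G t} \<subseteq> V \<times> V \<times> V \<times> V \<times> V" by (auto simp: K221_tuple_def V_def)
  have "real (card {t. K221_tuple G t}) = (\<Sum>t\<in>{t. K221_tuple G t}. 1)" by simp
  also have "\<dots> \<le> (\<Sum>t\<in>{t. K221_tuple G t}. (\<lambda>(x, x', y, y', w). nonadj G x x' * h x y y' w) t)"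
    by (intro sum_mono) (auto simp: K221_tuple_def h_def nonadj_def)
  also have "\<dots> \<le> (\<Sum>t\<in>V \<times> V \<times> V \<times> V \<times> V. (\<lambda>(x, x', y, y', w). nonadj G x x' * h x y y' w) t)"
    using sub V by (intro sum_mono2) (auto simp: h_def nonadj_def)
  also have "\<dots> = (\<Sum>x\<in>V. \<Sum>x'\<in>V. \<Sum>y\<in>V. \<Sum>y'\<in>V. \<Sum>w\<in>V. nonadj G x x' * h x y y' w)"
    by (simp add: sum.cartesian_product)
  also have "\<dots> = (\<Sum>x\<in>V. (\<Sum>x'\<in>V. nonadj G x x') * (\<Sum>y\<in>V. \<Sum>y'\<in>V. \<Sum>w\<in>V. h x y y' w))"
    by (simp only: sum_distrib_right) (simp add: sum_distrib_left)
  also have "\<dots> = real (card V) ^ 5 * avg V (\<lambda>x. avg V (nonadj G x) *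
      avg V (\<lambda>y. avg V (\<lambda>y'. avg V (\<lambda>w. h x y y' w))))"
    proof -
    have "avg V (\<lambda>x. avg V (nonadj G x) * avg V (\<lambda>y. avg V (\<lambda>y'. avg V (\<lambda>w. h x y y' w))))
      = (\<Sum>x\<in>V. (\<Sum>x'\<in>V. nonadj G x x') * (\<Sum>y\<in>V. \<Sum>y'\<in>V. \<Sum>w\<in>V. h x y y' w)) / real (card V) ^ 5"
      by (simp add: avg_def power_numeral_reduce mult_ac flip: sum_divide_distrib)
    then show ?thesis using V by simp
  qed
  finally show ?thesis unfolding h_def .
qed

section \<open>Edge density as average non-adjacency\<close>

lemma ind_count_K2:
  fixes G :: "'a sgraph"
  assumes G: "fin_simple_graph G"
  shows "ind_count (complete_graph 2) G = card (eset G)"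
proof -
  have V2: "vset (complete_graph 2) = {0, 1}" by (auto simp: complete_graph_def)
  have E2: "{p, q} \<in> eset (complete_graph 2) \<longleftrightarrow> p \<in> {0, 1} \<and> q \<in> {0, 1} \<and> p \<noteq> q" for p q
    by (auto simp: complete_graph_def card_insert_if)
  have "W \<subseteq> vset G \<and> graph_iso (induced_sub G W) (complete_graph 2) \<longleftrightarrow> W \<in> eset G" for W
  proof
    assume "W \<subseteq> vset G \<and> graph_iso (induced_sub G W) (complete_graph 2)"
    then obtain f where f: "bij_betw f W {0, 1}"
      and f_adj: "\<forall>u\<in>W. \<forall>v\<in>W. {u, v} \<in> {e \<in> eset G. e \<subseteq> W} \<longleftrightarrow> {f u, f v} \<in> eset (complete_graph 2)"
      unfolding graph_iso_def induced_sub_def fst_conv snd_conv V2 by blast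
    have "card W = 2" using bij_betw_same_card[OF f] by simp
    then obtain a b where W: "W = {a, b}" "a \<noteq> b" by (auto simp: card_2_iff)
    then have "f a \<in> {0, 1}" "f b \<in> {0, 1}" "f a \<noteq> f b"
      using f by (auto simp: bij_betw_def inj_on_def)
    then show "W \<in> eset G" using f_adj W by (simp add: E2)
  next
    assume W: "W \<in> eset G"
    then have "card W = 2" and sub: "W \<subseteq> vset G" using G by (auto simp: fin_simple_graph_def)
    then obtain a b where ab: "W = {a, b}" "a \<noteq> b" by (auto simp: card_2_iff)
    define f where "f = (\<lambda>v. if v = a then 0 else 1 :: nat)"
    have "bij_betw f W {0, 1}" using ab by (auto simp: bij_betw_def inj_on_def f_def)
    moreover have "{u, v} \<in> {e \<in> eset G. e \<subseteq> W} \<longleftrightarrow> {f u, f v} \<in> eset (complete_graph 2)"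
      if "u \<in> W" "v \<in> W" for u v
      using that W ab no_loop[OF G] edge_commute[of a b "eset G"] unfolding E2 by (auto simp: f_def)
    ultimately have "graph_iso (induced_sub G W) (complete_graph 2)"
      unfolding graph_iso_def induced_sub_def fst_conv snd_conv V2 by blast
    then show "W \<subseteq> vset G \<and> graph_iso (induced_sub G W) (complete_graph 2)" using sub by blast
  qed
  then show ?thesis by (simp add: ind_count_def)
qed

lemma card_ordered_edges:
  fixes G :: "'a sgraph"
  assumes G: "fin_simple_graph G"
  shows "card {(x, y). {x, y} \<in> eset G} = 2 * card (eset G)"
proof -
  define B where "B = (\<lambda>e::'a set. {(x, y). {x, y} = e})"
  have finE: "finite (eset G)"
    by (rule finite_subset[of _ "Pow (vset G)"]) (use G in \<open>auto simp: fin_simple_graph_def\<close>)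
  have B: "card (B e) = 2 \<and> finite (B e)" if "e \<in> eset G" for e
  proof -
    have "card e = 2" using G that by (auto simp: fin_simple_graph_def)
    then obtain a b where "e = {a, b}" "a \<noteq> b" by (auto simp: card_2_iff)
    then have "B e = {(a, b), (b, a)}" by (auto simp: B_def doubleton_eq_iff)
    then show ?thesis using \<open>a \<noteq> b\<close> by simp
  qed
  have "{(x, y). {x, y} \<in> eset G} = (\<Union>e\<in>eset G. B e)" by (auto simp: B_def)
  also have "card \<dots> = (\<Sum>e\<in>eset G. card (B e))"
    using finE B by (intro card_UN_disjoint) (auto simp: B_def)
  also have "\<dots> = 2 * card (eset G)" using B by simp
  finally show ?thesis .
qed

text \<open>The average runs over all ordered pairs including the diagonal, where
  \<open>nonadj\<close> is 1; the factor \<open>(N - 1) / N\<close> converts from pairs of distinct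
  vertices.\<close>

lemma avg_nonadj:
  fixes G :: "'a sgraph"
  assumes G: "fin_simple_graph G" and N: "card (vset G) \<ge> 2"
  shows "avg (vset G) (\<lambda>x. avg (vset G) (nonadj G x))
    = 1 - ind_density (complete_graph 2) G * ((real (card (vset G)) - 1) / real (card (vset G)))"
proof -
  define N where "N = real (card (vset G))"
  have fin: "finite (vset G)" using G by (simp add: fin_simple_graph_def)
  have "N \<ge> 2" using N by (simp add: N_def)
  have "(\<Sum>x\<in>vset G. \<Sum>y\<in>vset G. nonadj G x y)
      = (\<Sum>x\<in>vset G. \<Sum>y\<in>vset G. 1 - of_bool ({x, y} \<in> eset G))"
    by (intro sum.cong refl) (simp add: nonadj_def)
  also have "\<dots> = N\<^sup>2 - (\<Sum>(x, y)\<in>vset G \<times> vset G. of_bool ({x, y} \<in> eset G))"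
    by (simp add: sum_subtractf sum.cartesian_product power2_eq_square N_def)
  also have "(\<Sum>(x, y)\<in>vset G \<times> vset G. of_bool ({x, y} \<in> eset G) :: real)
      = (\<Sum>(x, y)\<in>{(x, y). {x, y} \<in> eset G}. 1)"
    using G fin by (intro sum.mono_neutral_cong_right) (auto simp: fin_simple_graph_def)
  also have "\<dots> = real (card {(x, y). {x, y} \<in> eset G})" by simp
  also have "\<dots> = 2 * real (card (eset G))" unfolding card_ordered_edges[OF G] by simp
  finally have "avg (vset G) (\<lambda>x. avg (vset G) (nonadj G x)) = (N\<^sup>2 - 2 * real (card (eset G))) / N\<^sup>2"
    by (simp add: avg_def N_def power2_eq_square flip: sum_divide_distrib)
  moreover have "ind_density (complete_graph 2) G = real (card (eset G)) / (N * (N - 1) / 2)"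
  proof -
    have "card (vset (complete_graph 2)) = 2" by (simp add: complete_graph_def)
    moreover have "real (card (vset G) choose 2) = N * (N - 1) / 2"
      by (simp add: binomial_gbinomial gbinomial_prod_rev numeral_2_eq_2 N_def)
    ultimately show ?thesis by (simp only: ind_density_def ind_count_K2[OF G])
  qed
  moreover have "(N\<^sup>2 - 2 * E) / N\<^sup>2 = 1 - E / (N * (N - 1) / 2) * ((N - 1) / N)" for E
    using \<open>N \<ge> 2\<close> by (simp add: field_simps power2_eq_square)
  ultimately show ?thesis unfolding N_def[symmetric] by simp
qed

section \<open>From counts to densities and limits\<close>

lemma choose_5: "real (n choose 5) = real n * (real n - 1) * (real n - 2) * (real n - 3) * (real n - 4) / 120"
  by (simp add: binomial_gbinomial gbinomial_prod_rev eval_nat_numeral)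

lemma card_vset_K221: "card (vset K221) = 5"
  by (simp add: vset_K221)

lemma ind_density_K221_le:
  fixes G :: "'a sgraph"
  assumes G: "fin_simple_graph G" and N: "card (vset G) \<ge> 2" and sigma: "0 < \<sigma>" "\<sigma> \<le> 1/3"
  defines "s \<equiv> avg (vset G) (\<lambda>x. avg (vset G) (nonadj G x))"
  shows "ind_density K221 G \<le> real (card (vset G)) ^ 5 / real (card (vset G) choose 5) / 8 *
    (s * (\<sigma> * (1 - \<sigma>) * (1 - 2 * \<sigma>)) - 3 * \<sigma>\<^sup>2 * (1 - 2 * \<sigma>) * (s - \<sigma>) + \<bar>s - \<sigma>\<bar>)"
proof -
  let ?B = "s * (\<sigma> * (1 - \<sigma>) * (1 - 2 * \<sigma>)) - 3 * \<sigma>\<^sup>2 * (1 - 2 * \<sigma>) * (s - \<sigma>) + \<bar>s - \<sigma>\<bar>"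
  have V: "finite (vset G)" "vset G \<noteq> {}" using G N by (auto simp: fin_simple_graph_def)
  interpret N: nonadjacency "vset G" "nonadj G"
    by unfold_locales (auto simp: V nonadj_def insert_commute no_loop[OF G])
  have "8 * real (ind_count K221 G) \<le> real (card {t. K221_tuple G t})"
    using ind_count_K221_le_tuples[OF G] by linarith
  also note card_tuples_le_avg[OF G V(2)]
  also have "real (card (vset G)) ^ 5 * avg (vset G) (\<lambda>x. avg (vset G) (nonadj G x) *
      avg (vset G) (\<lambda>y. avg (vset G) (\<lambda>y'. avg (vset G) (\<lambda>w.
      nonadj G y y' * (1 - nonadj G x y) * (1 - nonadj G x y') * (1 - nonadj G x w) * (1 - nonadj G y w)))))
    \<le> real (card (vset G)) ^ 5 * ?B"
    unfolding s_def
    by (intro mult_left_mono N.avg_K221_le[OF sigma, unfolded N.s_def N.d_def[abs_def] N.e_def]) simp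
  finally have "real (ind_count K221 G) \<le> real (card (vset G)) ^ 5 / 8 * ?B" by simp
  then have "real (ind_count K221 G) / real (card (vset G) choose 5)
      \<le> real (card (vset G)) ^ 5 / 8 * ?B / real (card (vset G) choose 5)"
    by (intro divide_right_mono) auto
  then show ?thesis by (simp add: ind_density_def card_vset_K221 mult_ac)
qed

text \<open>The edge density forces \<open>s n\<close> to tend to \<open>\<sigma>\<close>, so the
  tangent correction and the error \<open>\<bar>s n - \<sigma>\<bar>\<close> vanish in the
  limit.\<close>

lemma max_ind_density_K221_le:
  assumes sigma: "0 < \<sigma>" "\<sigma> \<le> 1/3"
  shows "max_ind_density K221 (1 - \<sigma>) \<le> ereal (15 * \<sigma>\<^sup>2 * (1 - \<sigma>) * (1 - 2 * \<sigma>))"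
  unfolding max_ind_density_def
proof (rule SUP_least)
  fix G assume "G \<in> graph_seqs (1 - \<sigma>)"
  then have G: "\<And>n. fin_simple_graph (G n)"
    and N: "filterlim (\<lambda>n. card (vset (G n))) at_top sequentially"
    and dens: "(\<lambda>n. ind_density (complete_graph 2) (G n)) \<longlonglongrightarrow> 1 - \<sigma>"
    by (auto simp: graph_seqs_def)
  define s where "s = (\<lambda>n. avg (vset (G n)) (\<lambda>x. avg (vset (G n)) (nonadj (G n) x)))"
  define c where "c = (\<lambda>n. real (card (vset (G n))) ^ 5 / real (card (vset (G n)) choose 5) / 8)"
  define u where "u = (\<lambda>n. c n *
    (s n * (\<sigma> * (1 - \<sigma>) * (1 - 2 * \<sigma>)) - 3 * \<sigma>\<^sup>2 * (1 - 2 * \<sigma>) * (s n - \<sigma>) + \<bar>s n - \<sigma>\<bar>))"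
  have N2: "eventually (\<lambda>n. card (vset (G n)) \<ge> 2) sequentially"
    using N by (simp add: filterlim_at_top)
  have NR: "filterlim (\<lambda>n. real (card (vset (G n)))) at_top sequentially"
    by (rule filterlim_compose[OF filterlim_real_sequentially N])
  have "((\<lambda>x::real. (x - 1) / x) \<longlongrightarrow> 1) at_top" by real_asymp
  from filterlim_compose[OF this NR]
  have "(\<lambda>n. 1 - ind_density (complete_graph 2) (G n) *
      ((real (card (vset (G n))) - 1) / real (card (vset (G n))))) \<longlonglongrightarrow> 1 - (1 - \<sigma>) * 1"
    by (intro tendsto_intros dens)
  moreover have "eventually (\<lambda>n. 1 - ind_density (complete_graph 2) (G n) *
      ((real (card (vset (G n))) - 1) / real (card (vset (G n)))) = s n) sequentially"
    using N2 by eventually_elim (simp add: s_def avg_nonadj[OF G])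
  ultimately have s: "s \<longlonglongrightarrow> \<sigma>" using filterlim_cong[OF refl refl] by fastforce
  \<comment> \<open>The limit 15 is \<open>5! / 8\<close>: orderings of five vertices over
    automorphisms of \<open>K221\<close>.\<close>
  have "((\<lambda>x::real. x ^ 5 / (x * (x - 1) * (x - 2) * (x - 3) * (x - 4) / 120) / 8) \<longlongrightarrow> 15) at_top"
    by real_asymp
  from filterlim_compose[OF this NR] have c: "c \<longlonglongrightarrow> 15" by (simp add: c_def choose_5)
  have "u \<longlonglongrightarrow> 15 * (\<sigma> * (\<sigma> * (1 - \<sigma>) * (1 - 2 * \<sigma>)) - 3 * \<sigma>\<^sup>2 * (1 - 2 * \<sigma>) * (\<sigma> - \<sigma>) + \<bar>\<sigma> - \<sigma>\<bar>)"
    unfolding u_def by (intro tendsto_intros s c)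
  then have u: "u \<longlonglongrightarrow> 15 * \<sigma>\<^sup>2 * (1 - \<sigma>) * (1 - 2 * \<sigma>)" by (simp add: power2_eq_square algebra_simps)
  have "limsup (\<lambda>n. ereal (ind_density K221 (G n))) \<le> limsup (\<lambda>n. ereal (u n))"
  proof (rule Limsup_mono)
    show "\<forall>\<^sub>F n in sequentially. ereal (ind_density K221 (G n)) \<le> ereal (u n)"
      using N2
    proof eventually_elim
      case (elim n)
      then show ?case
        using ind_density_K221_le[OF G elim sigma] by (simp only: ereal_less_eq u_def c_def s_def)
    qed
  qed
  also have "\<dots> = ereal (15 * \<sigma>\<^sup>2 * (1 - \<sigma>) * (1 - 2 * \<sigma>))"
    using u by (intro lim_imp_Limsup) auto
  finally show "limsup (\<lambda>n. ereal (ind_density K221 (G n))) \<le> ereal (15 * \<sigma>\<^sup>2 * (1 - \<sigma>) * (1 - 2 * \<sigma>))" .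
qed

section \<open>Balanced complete multipartite graphs\<close>

text \<open>The complete \<open>k\<close>-partite graph with parts of size \<open>n\<close>, encoded
  on natural numbers as \<open>graph_seqs\<close> demands; the part of a vertex is its quotient by
  \<open>n\<close>.\<close>

definition balanced_graph :: "nat \<Rightarrow> nat \<Rightarrow> nat sgraph" where
  "balanced_graph k n = ({..<k * n}, {{u, v} | u v. u < k * n \<and> v < k * n \<and> u div n \<noteq> v div n})"

lemma vset_balanced: "vset (balanced_graph k n) = {..<k * n}"
  by (simp add: balanced_graph_def)

lemma eset_balanced:
  "{u, v} \<in> eset (balanced_graph k n) \<longleftrightarrow> u < k * n \<and> v < k * n \<and> u div n \<noteq> v div n"
  by (auto simp: balanced_graph_def doubleton_eq_iff)

lemma balanced_simple: "fin_simple_graph (balanced_graph k n)"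
  by (auto simp: fin_simple_graph_def balanced_graph_def card_insert_if)

lemma div_fibre:
  assumes "n > 0"
  shows "{v. v div n = i} = {i * n..<i * n + (n::nat)}"
proof -
  have "v div n = i \<longleftrightarrow> i \<le> v div n \<and> v div n < Suc i" for v by linarith
  then have "v div n = i \<longleftrightarrow> i * n \<le> v \<and> v < Suc i * n" for v
    unfolding less_eq_div_iff_mult_less_eq[OF assms] div_less_iff_less_mult[OF assms] .
  then show ?thesis by (simp add: set_eq_iff add.commute)
qed

lemma card_div_fibre: "n > 0 \<Longrightarrow> card {v. v div n = (i::nat)} = n"
  by (simp add: div_fibre)

lemma finite_div_fibre: "n > 0 \<Longrightarrow> finite {v. v div n = (i::nat)}"
  by (simp add: div_fibre)

lemma div_less_iff: "n > 0 \<Longrightarrow> v div n < k \<longleftrightarrow> v < k * (n::nat)"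
  by (simp add: div_less_iff_less_mult)

text \<open>The vertices not adjacent to a given one form its part, a fraction \<open>1 / k\<close>
  of all; solving \<open>avg_nonadj\<close> for the density gives the formula.\<close>

lemma balanced_edge_density:
  assumes k: "k > 0" and n: "n > 0" and kn: "k * n \<ge> 2"
  shows "ind_density (complete_graph 2) (balanced_graph k n)
    = (1 - 1 / real k) * (real k * real n / (real k * real n - 1))"
proof -
  let ?G = "balanced_graph k n"
  have "avg (vset ?G) (nonadj ?G x) = 1 / real k" if "x \<in> vset ?G" for x
  proof -
    have x: "x < k * n" using that by (simp add: vset_balanced)
    have "(\<Sum>y<k * n. nonadj ?G x y) = real (card {y \<in> {..<k * n}. y div n = x div n})"
      using x by (simp add: nonadj_def eset_balanced of_bool_def eq_commute flip: sum.inter_filter)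
    also have "{y \<in> {..<k * n}. y div n = x div n} = {y. y div n = x div n}"
    proof -
      have "y < k * n" if "y div n = x div n" for y
        using x unfolding div_less_iff[OF n, symmetric] that .
      then show ?thesis by blast
    qed
    finally show ?thesis using n k by (simp add: avg_def vset_balanced card_div_fibre)
  qed
  then have "avg (vset ?G) (\<lambda>x. avg (vset ?G) (nonadj ?G x)) = avg (vset ?G) (\<lambda>x. 1 / real k)"
    by (intro avg_cong)
  also have "\<dots> = 1 / real k" using k n by (intro avg_const) (auto simp: vset_balanced lessThan_empty_iff)
  finally have *: "1 - ind_density (complete_graph 2) ?G * ((real (k * n) - 1) / real (k * n)) = 1 / real k"
    using avg_nonadj[OF balanced_simple, of k n] kn by (simp add: vset_balanced)
  have "real (k * n) \<ge> 2" using kn by linarith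
  then show ?thesis using * k n by (simp add: field_simps)
qed

definition part_pairs :: "nat \<Rightarrow> nat \<Rightarrow> nat set set" where
  "part_pairs n i = {A. A \<subseteq> {v. v div n = i} \<and> card A = 2}"

text \<open>Two parts \<open>i < j\<close> contribute a pair each and a third part \<open>l\<close>
  a single vertex; distinct choices give distinct copies. The sum over \<open>j\<close> counts the
  pairs \<open>i < j\<close>.\<close>

lemma ind_count_K221_balanced:
  assumes n: "n > 0"
  shows "(\<Sum>j<k. j) * (k - 2) * ((n choose 2) * (n choose 2) * n) \<le> ind_count K221 (balanced_graph k n)"
proof -
  define I where "I = (SIGMA (j, i) : (SIGMA j:{..<k}. {..<j}). {..<k} - {i, j})"
  define X where "X = (SIGMA ((j, i), l) : I. part_pairs n i \<times> part_pairs n j \<times> {v. v div n = l})"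
  define U where "U = (\<lambda>(t :: (nat \<times> nat) \<times> nat, A :: nat set, B :: nat set, w :: nat). A \<union> B \<union> {w})"
  have fin_pairs: "finite (part_pairs n i)" and card_pairs: "card (part_pairs n i) = n choose 2" for i
    using n_subsets[of "{v. v div n = i}" 2] n
    by (auto simp: part_pairs_def finite_div_fibre card_div_fibre)
  have card_I: "card I = (\<Sum>j<k. j) * (k - 2)" "finite I"
  proof -
    have "card I = (\<Sum>p\<in>(SIGMA j:{..<k}. {..<j}). card ((\<lambda>(j, i). {..<k} - {i, j}) p))"
      unfolding I_def by (rule card_SigmaI) auto
    also have "\<dots> = (\<Sum>p\<in>(SIGMA j:{..<k}. {..<j}). k - 2)"
    proof (rule sum.cong[OF refl])
      fix p assume "p \<in> (SIGMA j:{..<k}. {..<j})"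
      then obtain j i where p: "p = (j, i)" "j < k" "i < j" by auto
      have "card ({..<k} - {i, j}) = card {..<k} - card {i, j}"
        using p by (intro card_Diff_subset) auto
      also have "card {i, j} = 2" using p by simp
      finally show "card ((\<lambda>(j, i). {..<k} - {i, j}) p) = k - 2" by (simp only: p prod.case card_lessThan)
    qed
    also have "\<dots> = (\<Sum>j<k. j) * (k - 2)" by simp
    finally show "card I = (\<Sum>j<k. j) * (k - 2)" .
    show "finite I" unfolding I_def by (intro finite_SigmaI) auto
  qed
  define F where "F = (\<lambda>((j, i), l). part_pairs n i \<times> part_pairs n j \<times> {v. v div n = (l::nat)})"
  have F: "finite (F t)" "card (F t) = (n choose 2) * (n choose 2) * n" for t
    using fin_pairs card_pairs n
    by (auto simp: F_def case_prod_unfold card_cartesian_product card_div_fibre finite_div_fibre)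
  have "card X = card (Sigma I F)" by (simp add: X_def F_def case_prod_unfold)
  also have "\<dots> = (\<Sum>t\<in>I. (n choose 2) * (n choose 2) * n)"
    using card_I(2) F by (subst card_SigmaI) auto
  finally have "card X = (\<Sum>t\<in>I. (n choose 2) * (n choose 2) * n)" .
  then have card_X: "card X = (\<Sum>j<k. j) * (k - 2) * ((n choose 2) * (n choose 2) * n)"
    by (simp add: card_I)
  have meet: "(A \<union> B \<union> {w}) \<inter> {v. v div n = m}
      = (if m = i then A else if m = j then B else if m = l then {w} else {})"
    if "A \<in> part_pairs n i" "B \<in> part_pairs n j" "w div n = l" "i \<noteq> j" "i \<noteq> l" "j \<noteq> l" for A B w i j l m
    using that by (auto simp: part_pairs_def)
  have "inj_on U X"
  proof (rule inj_onI)
    fix p p' assume p: "p \<in> X" and p': "p' \<in> X" and eq: "U p = U p'"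
    obtain i j l A B w where p_eq: "p = (((j, i), l), (A, B, w))"
      by (rule that[of "fst (fst (fst p))" "snd (fst (fst p))" "snd (fst p)"
          "fst (snd p)" "fst (snd (snd p))" "snd (snd (snd p))"]) simp
    obtain i' j' l' A' B' w' where p'_eq: "p' = (((j', i'), l'), (A', B', w'))"
      by (rule that[of "fst (fst (fst p'))" "snd (fst (fst p'))" "snd (fst p')"
          "fst (snd p')" "fst (snd (snd p'))" "snd (snd (snd p'))"]) simp
    have A: "A \<in> part_pairs n i" "B \<in> part_pairs n j" "w div n = l" "i < j" "i \<noteq> l" "j \<noteq> l"
      using p by (auto simp: p_eq X_def I_def)
    have A': "A' \<in> part_pairs n i'" "B' \<in> part_pairs n j'" "w' div n = l'" "i' < j'" "i' \<noteq> l'" "j' \<noteq> l'"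
      using p' by (auto simp: p'_eq X_def I_def)
    \<comment> \<open>The traces of the vertex set on the parts recover the choice: their sizes
      single out \<open>l\<close> and the set \<open>{i, j}\<close>, and \<open>i < j\<close> fixes
      the order.\<close>
    define S where "S = (\<lambda>m. U p \<inter> {v. v div n = m})"
    have S: "S m = (if m = i then A else if m = j then B else if m = l then {w} else {})" for m
      using meet[OF A(1,2,3) _ A(5,6)] A(4) by (simp add: S_def p_eq U_def)
    have S': "S m = (if m = i' then A' else if m = j' then B' else if m = l' then {w'} else {})" for m
      using meet[OF A'(1,2,3) _ A'(5,6)] A'(4)
      by (simp only: S_def eq) (simp add: p'_eq U_def)
    have "card A = 2" "card B = 2" "card A' = 2" "card B' = 2"
      using A A' by (auto simp: part_pairs_def)
    note cards = this
    have c: "card (S m) = (if m = i \<or> m = j then 2 else if m = l then 1 else 0)" for m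
      using cards by (simp add: S)
    have c': "card (S m) = (if m = i' \<or> m = j' then 2 else if m = l' then 1 else 0)" for m
      using cards by (simp add: S')
    have "{m. card (S m) = 2} = {i, j}" "{m. card (S m) = 1} = {l}"
      using A(4-6) by (auto simp: c)
    moreover have "{m. card (S m) = 2} = {i', j'}" "{m. card (S m) = 1} = {l'}"
      using A'(4-6) by (auto simp: c')
    ultimately have "{i, j} = {i', j'}" "{l} = {l'}" by simp_all
    then have ijl: "i' = i" "j' = j" "l' = l" using A(4) A'(4) by (auto simp: doubleton_eq_iff)
    have "A = A'" using S[of i] S'[of i] ijl by simp
    moreover have "B = B'" using S[of j] S'[of j] ijl A(4) by simp
    moreover have "w = w'" using S[of l] S'[of l] ijl A(5,6) by simp
    ultimately show "p = p'" by (simp add: p_eq p'_eq ijl)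
  qed
  moreover have "U ` X \<subseteq> {W. W \<subseteq> vset (balanced_graph k n) \<and> graph_iso (induced_sub (balanced_graph k n) W) K221}"
  proof
    fix W assume "W \<in> U ` X"
    then obtain i j l A B w where "(((j, i), l), (A, B, w)) \<in> X" and W: "W = A \<union> B \<union> {w}"
      by (auto simp: U_def)
    then have A: "A \<in> part_pairs n i" "B \<in> part_pairs n j" "w div n = l" "i < j" "i \<noteq> l" "j \<noteq> l" "j < k" "l < k"
      by (auto simp: X_def I_def)
    obtain a a' where a: "A = {a, a'}" "a \<noteq> a'" using A(1) by (auto simp: part_pairs_def card_2_iff)
    obtain b b' where b: "B = {b, b'}" "b \<noteq> b'" using A(2) by (auto simp: part_pairs_def card_2_iff)
    have div: "a div n = i" "a' div n = i" "b div n = j" "b' div n = j"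
      using A a b by (auto simp: part_pairs_def)
    have less: "a < k * n" "a' < k * n" "b < k * n" "b' < k * n" "w < k * n"
      using div A(3-8) by (auto simp flip: div_less_iff[OF n])
    have "K221_tuple (balanced_graph k n) (a, a', b, b', w)"
      using a(2) b(2) div less A(3-6) unfolding K221_tuple_def by (simp add: eset_balanced vset_balanced)
    moreover have "tuple_set (a, a', b, b', w) = W" using W a b by (auto simp: tuple_set_def)
    ultimately show "W \<in> {W. W \<subseteq> vset (balanced_graph k n) \<and> graph_iso (induced_sub (balanced_graph k n) W) K221}"
      using graph_iso_K221_iff[OF balanced_simple] by blast
  qed
  moreover have "finite {W. W \<subseteq> vset (balanced_graph k n) \<and> graph_iso (induced_sub (balanced_graph k n) W) K221}"
    by (rule finite_subset[of _ "Pow {..<k * n}"]) (auto simp: vset_balanced)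
  ultimately have "card X \<le> ind_count K221 (balanced_graph k n)"
    unfolding ind_count_def by (rule card_inj_on_le)
  then show ?thesis by (simp add: card_X)
qed

lemma max_ind_density_K221_ge:
  fixes k :: nat
  assumes k: "k \<ge> 3"
  shows "ereal (15 * (real k - 1) * (real k - 2) / real k ^ 4) \<le> max_ind_density K221 ((real k - 1) / real k)"
proof -
  define G where "G = balanced_graph k"
  define x where "x = real k"
  have x: "x \<ge> 3" using k by (simp add: x_def)
  have large: "eventually (\<lambda>n. n \<ge> 2) sequentially" by (rule eventually_ge_at_top)
  have G_seq: "G \<in> graph_seqs ((real k - 1) / real k)"
  proof -
    have "filterlim (\<lambda>n. k * n) at_top sequentially"
      using k by (intro filterlim_subseq) (auto simp: strict_mono_def)
    moreover have "(\<lambda>n. ind_density (complete_graph 2) (G n)) \<longlonglongrightarrow> (x - 1) / x"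
    proof (rule Lim_transform_eventually)
      show "(\<lambda>n. (1 - 1 / x) * (x * real n / (x * real n - 1))) \<longlonglongrightarrow> (x - 1) / x"
      proof -
        have "(\<lambda>n. x * real n / (x * real n - 1)) \<longlonglongrightarrow> 1" using x by real_asymp
        from tendsto_mult[OF tendsto_const[of "1 - 1 / x"] this] show ?thesis
          using x by (simp add: diff_divide_distrib)
      qed
      show "\<forall>\<^sub>F n in sequentially. (1 - 1 / x) * (x * real n / (x * real n - 1)) = ind_density (complete_graph 2) (G n)"
        using large
      proof eventually_elim
        case (elim n)
        have "2 * 1 \<le> k * n" using k elim by (intro mult_mono) auto
        then show ?case using balanced_edge_density[of k n] k elim by (simp add: G_def x_def)
      qed
    qed
    ultimately show ?thesis by (simp add: graph_seqs_def G_def balanced_simple vset_balanced x_def)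
  qed
  \<comment> \<open>The lower bound on the count divided by the binomial coefficient, as an explicit
    rational function of \<open>n\<close>.\<close>
  define u where "u = (\<lambda>n. x * (x - 1) / 2 * (x - 2) * ((real n * (real n - 1) / 2)\<^sup>2 * real n) /
      ((x * real n) * (x * real n - 1) * (x * real n - 2) * (x * real n - 3) * (x * real n - 4) / 120))"
  have u_le: "u n \<le> ind_density K221 (G n)" if "n \<ge> 2" for n
  proof -
    have "2 * (\<Sum>j<k. real j) = real k * (real k - 1)" by (induction k) (auto simp: algebra_simps)
    then have sum: "(\<Sum>j<k. real j) = x * (x - 1) / 2" by (simp add: x_def)
    have "real (n choose 2) = real n * (real n - 1) / 2"
      by (simp add: binomial_gbinomial gbinomial_prod_rev numeral_2_eq_2)
    moreover have "real ((\<Sum>j<k. j) * (k - 2) * ((n choose 2) * (n choose 2) * n))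
        = (\<Sum>j<k. real j) * (x - 2) * ((real (n choose 2))\<^sup>2 * real n)"
      using k by (simp add: of_nat_diff x_def power2_eq_square)
    ultimately have "real ((\<Sum>j<k. j) * (k - 2) * ((n choose 2) * (n choose 2) * n))
        = x * (x - 1) / 2 * (x - 2) * ((real n * (real n - 1) / 2)\<^sup>2 * real n)"
      by (simp only: sum)
    moreover have "real ((\<Sum>j<k. j) * (k - 2) * ((n choose 2) * (n choose 2) * n)) \<le> real (ind_count K221 (G n))"
      unfolding G_def of_nat_le_iff using that by (intro ind_count_K221_balanced) auto
    ultimately have "x * (x - 1) / 2 * (x - 2) * ((real n * (real n - 1) / 2)\<^sup>2 * real n) \<le> real (ind_count K221 (G n))"
      by (rule ord_eq_le_trans[OF sym])
    then have "x * (x - 1) / 2 * (x - 2) * ((real n * (real n - 1) / 2)\<^sup>2 * real n) / real (k * n choose 5) \<le> ind_density K221 (G n)"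
      unfolding ind_density_def card_vset_K221 G_def vset_balanced card_lessThan by (intro divide_right_mono) auto
    then show ?thesis by (simp only: u_def choose_5 x_def of_nat_mult)
  qed
  have "u \<longlonglongrightarrow> 15 * (x - 1) * (x - 2) / x ^ 4"
  proof -
    \<comment> \<open>Quotient of the coefficients of \<open>n ^ 5\<close> in numerator and
      denominator.\<close>
    have "u \<longlonglongrightarrow> 120 * (x * (x - 1) / 2 * (x - 2) / 4) / x ^ 5"
      unfolding u_def using x by (real_asymp simp: field_simps power_numeral_reduce)
    also have "120 * (x * (x - 1) / 2 * (x - 2) / 4) / x ^ 5 = 15 * (x - 1) * (x - 2) / x ^ 4"
      using x by (simp add: field_simps power_numeral_reduce)
    finally show ?thesis .
  qed
  then have "limsup (\<lambda>n. ereal (u n)) = ereal (15 * (x - 1) * (x - 2) / x ^ 4)"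
    by (intro lim_imp_Limsup) auto
  moreover have "limsup (\<lambda>n. ereal (u n)) \<le> limsup (\<lambda>n. ereal (ind_density K221 (G n)))"
    by (rule Limsup_mono, use large in eventually_elim) (simp add: u_le)
  moreover have "limsup (\<lambda>n. ereal (ind_density K221 (G n))) \<le> max_ind_density K221 ((real k - 1) / real k)"
    unfolding max_ind_density_def by (rule SUP_upper[OF G_seq])
  ultimately show ?thesis by (simp add: x_def)
qed

section \<open>Both bounds at \<open>\<sigma> = 1 / k\<close>\<close>

theorem theorem1p6:
  fixes k :: real
  assumes "k \<ge> 3"
  shows "max_ind_density K221 ((k - 1) / k) \<le> ereal (15 * (k - 1) * (k - 2) / k ^ 4) \<and>
    (k \<in> \<int> \<longrightarrow>
      max_ind_density K221 ((k - 1) / k) = ereal (15 * (k - 1) * (k - 2) / k ^ 4))"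
proof -
  have "1 - 1 / k = (k - 1) / k" "15 * (1 / k)\<^sup>2 * (1 - 1 / k) * (1 - 2 * (1 / k)) = 15 * (k - 1) * (k - 2) / k ^ 4"
    using assms by (simp_all add: field_simps power_numeral_reduce)
  moreover have "0 < 1 / k" "1 / k \<le> 1 / 3" using assms by (auto simp: field_simps)
  ultimately have upper: "max_ind_density K221 ((k - 1) / k) \<le> ereal (15 * (k - 1) * (k - 2) / k ^ 4)"
    using max_ind_density_K221_le[of "1 / k"] by simp
  moreover have "max_ind_density K221 ((k - 1) / k) = ereal (15 * (k - 1) * (k - 2) / k ^ 4)" if "k \<in> \<int>"
  proof -
    obtain z where z: "k = of_int z" using \<open>k \<in> \<int>\<close> by (elim Ints_cases)
    then have "k = real (nat z)" using assms by simp
    moreover from this have "nat z \<ge> 3" using assms by linarith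
    ultimately show ?thesis using max_ind_density_K221_ge[of "nat z"] upper by (intro antisym) auto
  qed
  ultimately show ?thesis by blast
qed

end
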